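(* Let $n\geq 2$ be an integer, let $c\in\mathbb{R}$, and let $\{D_\alpha(h)\}$ be a finite collection of differences centered at $c$, each of order at least $n$. Then: (i) There is a function $f:\mathbb{R}\to\mathbb{R}$ that is $n-2$ times Peano differentiable at $c$, such that $D_\alpha(h)(f)\equiv 0$ (as a function of $h$) for all $\alpha$, but $f$ is not $n$ times Peano differentiable at $c$. (ii) If all the orders of the differences $D_\alpha(h)$ are greater than $n$, then there is a function $f:\mathbb{R}\to\mathbb{R}$ that is $n-1$ times Peano differentiable at $c$, such that $D_\alpha(h)(f)\equiv 0$ for all $\alpha$, but $f$ is not $n$ times Peano differentiable at $c$.
   Context: A difference centered at $c\in\mathbb{R}$ is an expression $D(h)(f)=\sum_{i=0}^m a_i f(c+b_i h)$, for functions $f:\mathbb{R}\to\mathbb{R}$ and real $h$, where the $a_i$ are non-zero real numbers (the coefficients) and the $b_i$ are distinct real numbers (the nodes). The difference has order $p$ if $D(1)(x^j)=0$ for $j=0,1,\ldots,p-1$ and $D(1)(x^p)\neq 0$; this does not depend on $c$, and is equivalent to $\sum_i a_i b_i^j=0$ for $0\le j\le p-1$ and $\sum_i a_i b_i^p\neq 0$ (with the convention $0^0=1$). A function $f$ is $r$ times Peano differentiable at $c$ ($r\ge 0$) if there is a polynomial $p$ such that $f(c+h)-p(c+h)=o(h^r)$, i.e. $\lim_{h\to0}\frac{f(c+h)-p(c+h)}{h^r}=0$. *)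

theory Defs
  imports Complex_Main "HOL-Computational_Algebra.Polynomial"
begin

text \<open>
  The term \<open>Difference m a b\<close> carries the data of the expression
  \<open>\<Sum>i\<le>m. a i * f (c + b i * h)\<close>.  Values of \<open>a\<close> and \<open>b\<close> beyond index \<open>m\<close> are irrelevant.
\<close>
datatype difference =
  Difference (last_index: nat) (coefficient: "nat \<Rightarrow> real") (node: "nat \<Rightarrow> real")

definition is_difference :: "difference \<Rightarrow> bool" where
  "is_difference D \<longleftrightarrow>
     (\<forall>i\<le>last_index D. coefficient D i \<noteq> 0) \<and> inj_on (node D) {..last_index D}"

definition apply_difference :: "real \<Rightarrow> difference \<Rightarrow> real \<Rightarrow> (real \<Rightarrow> real) \<Rightarrow> real" where
  "apply_difference c D h f = (\<Sum>i=0..last_index D. coefficient D i * f (c + node D i * h))"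

definition has_order :: "real \<Rightarrow> difference \<Rightarrow> nat \<Rightarrow> bool" where
  "has_order c D p \<longleftrightarrow>
     (\<forall>j<p. apply_difference c D 1 (\<lambda>x. x ^ j) = 0) \<and>
     apply_difference c D 1 (\<lambda>x. x ^ p) \<noteq> 0"

text \<open>
  The limit is the punctured one, and no bound is imposed on the degree of the polynomial:
  terms of degree above \<open>r\<close> in \<open>h\<close> are absorbed by the error term.
\<close>
definition peano_differentiable :: "nat \<Rightarrow> (real \<Rightarrow> real) \<Rightarrow> real \<Rightarrow> bool" where
  "peano_differentiable r f c \<longleftrightarrow>
     (\<exists>p :: real poly. ((\<lambda>h. (f (c + h) - poly p (c + h)) / h ^ r) \<longlongrightarrow> 0) (at 0))"

end

theory Submission
  imports Defs "HOL-Analysis.Continuum_Not_Denumerable"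
begin

text \<open>
  Let \<open>k \<ge> 1\<close> and suppose that every given difference annihilates \<open>(x - c) ^ k\<close>, that is,
  \<open>\<Sum>i. a i * b i ^ k = 0\<close>.  Let \<open>G\<close> be the multiplicative subgroup of the nonzero reals that is
  generated by the nonzero nodes of all the differences together with \<open>2\<close>, and put
  \<open>f (c + x) = x ^ k\<close> for \<open>x \<in> G\<close> and \<open>f (c + x) = 0\<close> otherwise.

  Multiplication by a nonzero node preserves both \<open>G\<close> and its complement, and the zero node
  contributes nothing because \<open>k \<ge> 1\<close>.  So a difference applied to \<open>f\<close> is either
  \<open>h ^ k * (\<Sum>i. a i * b i ^ k)\<close> or a sum of zeros, hence \<open>0\<close> (lemma
  \<open>apply_difference_cut_off_power\<close>).  Since \<open>\<bar>f (c + h)\<bar> \<le> \<bar>h\<bar> ^ k\<close>, the function \<open>f\<close> is \<open>k - 1\<close> times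
  Peano differentiable at \<open>c\<close>.  It is not \<open>k\<close> times Peano differentiable: \<open>G\<close> is countable, so
  there is some \<open>t \<noteq> 0\<close> outside \<open>G\<close>, and the points \<open>t / 2 ^ m\<close>, which lie outside \<open>G\<close>
  as well, force the approximating polynomial to be \<open>o(h ^ k)\<close> (lemma \<open>poly_small_along_filter\<close>),
  whereas \<open>f (c + h) / h ^ k = 1\<close> at the points \<open>h = 1 / 2 ^ m\<close> of \<open>G\<close>.

  Differences of order at least \<open>n\<close> annihilate \<open>(x - c) ^ (n - 1)\<close>, so part (i) is the case
  \<open>k = n - 1\<close>; differences of order greater than \<open>n\<close> annihilate \<open>(x - c) ^ n\<close>, so part (ii) is
  the case \<open>k = n\<close>.
\<close>

text \<open>
  The witness is the group generated by \<open>S\<close>, as the set of all quotients of finite products of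
  elements of \<open>S\<close>.
\<close>

lemma countable_multiplicatively_invariant_set:
  fixes S :: "real set"
  assumes "countable S" and "0 \<notin> S"
  obtains G where "countable G" and "1 \<in> G" and "\<And>s x. s \<in> S \<Longrightarrow> s * x \<in> G \<longleftrightarrow> x \<in> G"
proof
  let ?q = "\<lambda>(xs, ys). prod_list xs / prod_list ys :: real"
  let ?G = "?q ` (lists S \<times> lists S)"
  show "countable ?G"
    using assms(1) by (intro countable_image countable_SIGMA) auto
  show "1 \<in> ?G"
    by (rule image_eqI[of _ _ "([], [])"]) auto
  show "s * x \<in> ?G \<longleftrightarrow> x \<in> ?G" if "s \<in> S" for s x
  proof
    have "s \<noteq> 0" using that assms(2) by auto
    assume "s * x \<in> ?G"
    then obtain xs ys where "xs \<in> lists S" "ys \<in> lists S" "s * x = prod_list xs / prod_list ys"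
      by auto
    moreover from this(3) \<open>s \<noteq> 0\<close> have "x = prod_list xs / (s * prod_list ys)"
      by (metis divide_divide_eq_left mult.commute nonzero_mult_div_cancel_left)
    ultimately show "x \<in> ?G"
      using that by (intro image_eqI[of _ _ "(xs, s # ys)"]) auto
  next
    assume "x \<in> ?G"
    then obtain xs ys where "xs \<in> lists S" "ys \<in> lists S" "x = prod_list xs / prod_list ys"
      by auto
    with that show "s * x \<in> ?G"
      by (intro image_eqI[of _ _ "(s # xs, ys)"]) auto
  qed
qed

text \<open>
  If a polynomial is \<open>o(h ^ k)\<close> along some way of approaching \<open>0\<close>, such as a single sequence, then
  its coefficients up to degree \<open>k\<close> vanish, one after the other, and it is \<open>o(h ^ k)\<close> outright.
\<close>

lemma poly_small_along_filter:
  fixes Q :: "real poly"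
  assumes "F \<le> at 0" and "F \<noteq> bot" and "((\<lambda>h. poly Q h / h ^ k) \<longlongrightarrow> 0) F"
  shows "((\<lambda>h. poly Q h / h ^ k) \<longlongrightarrow> 0) (at 0)"
  using assms(3)
proof (induction k arbitrary: Q)
  case 0
  have lim: "(poly Q \<longlongrightarrow> poly Q 0) (at 0)"
    using poly_isCont[of 0 Q] by (simp add: isCont_def)
  have "(poly Q \<longlongrightarrow> poly Q 0) F"
    using lim assms(1) by (rule tendsto_mono[rotated])
  with 0 have "poly Q 0 = 0"
    using tendsto_unique[OF assms(2)] by fastforce
  with lim show ?case by simp
next
  case (Suc k)
  have nz: "eventually (\<lambda>h. h \<noteq> (0::real)) (at 0)"
    by (simp add: eventually_at_filter)
  have nzF: "eventually (\<lambda>h. h \<noteq> (0::real)) F"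
    using nz assms(1) by (rule filter_leD[rotated])
  have idF: "((\<lambda>h. h) \<longlongrightarrow> 0) F"
    using tendsto_ident_at assms(1) by (rule tendsto_mono[rotated])
  have "((\<lambda>h. poly Q h / h ^ Suc k * h ^ Suc k) \<longlongrightarrow> 0 * 0 ^ Suc k) F"
    by (intro tendsto_mult tendsto_power Suc.prems idF)
  then have "((\<lambda>h. poly Q h / h ^ Suc k * h ^ Suc k) \<longlongrightarrow> 0) F"
    by simp
  then have "(poly Q \<longlongrightarrow> 0) F"
    by (rule Lim_transform_eventually) (use nzF in \<open>eventually_elim, simp\<close>)
  moreover have "(poly Q \<longlongrightarrow> poly Q 0) F"
    using poly_isCont[of 0 Q] assms(1) by (auto simp: isCont_def intro: tendsto_mono)
  ultimately have "poly Q 0 = 0"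
    using tendsto_unique[OF assms(2)] by blast
  then obtain R where R: "Q = pCons 0 R"
    by (cases Q) auto
  have eq: "poly Q h / h ^ Suc k = poly R h / h ^ k" if "h \<noteq> 0" for h
    using that by (simp add: R)
  have "((\<lambda>h. poly R h / h ^ k) \<longlongrightarrow> 0) F"
    using Suc.prems by (rule Lim_transform_eventually) (rule eventually_mono[OF nzF eq])
  then have "((\<lambda>h. poly R h / h ^ k) \<longlongrightarrow> 0) (at 0)"
    by (rule Suc.IH)
  then show ?case
    by (rule Lim_transform_eventually) (rule eventually_mono[OF nz eq[symmetric]])
qed

lemma peano_differentiable_mono:
  assumes "peano_differentiable n f c" and "k \<le> n"
  shows "peano_differentiable k f c"
proof -
  obtain p where p: "((\<lambda>h. (f (c + h) - poly p (c + h)) / h ^ n) \<longlongrightarrow> 0) (at 0)"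
    using assms(1) by (auto simp: peano_differentiable_def)
  have "((\<lambda>h. (f (c + h) - poly p (c + h)) / h ^ n * h ^ (n - k)) \<longlongrightarrow> 0 * 0 ^ (n - k)) (at 0)"
    by (intro tendsto_mult p tendsto_power tendsto_ident_at)
  then have "((\<lambda>h. (f (c + h) - poly p (c + h)) / h ^ n * h ^ (n - k)) \<longlongrightarrow> 0) (at 0)"
    by simp
  moreover have "y / h ^ n * h ^ (n - k) = y / h ^ k" if "h \<noteq> 0" for y h :: real
  proof -
    have "h ^ n = h ^ k * h ^ (n - k)"
      using assms(2) by (simp flip: power_add)
    with that show ?thesis by simp
  qed
  then have "eventually (\<lambda>h. (f (c + h) - poly p (c + h)) / h ^ n * h ^ (n - k)
      = (f (c + h) - poly p (c + h)) / h ^ k) (at 0)"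
    by (simp add: eventually_at_filter)
  ultimately have "((\<lambda>h. (f (c + h) - poly p (c + h)) / h ^ k) \<longlongrightarrow> 0) (at 0)"
    by (rule Lim_transform_eventually)
  then show ?thesis
    unfolding peano_differentiable_def by (rule exI)
qed

text \<open>
  The conditions that define the order involve powers of \<open>c + b i\<close>; by the binomial theorem they
  do not depend on \<open>c\<close>.
\<close>

lemma has_order_imp_node_power_sum_eq_0:
  assumes "has_order c D p" and "k < p"
  shows "(\<Sum>i=0..last_index D. coefficient D i * node D i ^ k) = 0"
proof -
  have "node D i ^ k = (\<Sum>j\<le>k. of_nat (k choose j) * (- c) ^ (k - j) * (c + node D i) ^ j)" for i
    using binomial_ring[of "c + node D i" "- c" k] by (simp add: mult_ac)
  then have "(\<Sum>i=0..last_index D. coefficient D i * node D i ^ k)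
      = (\<Sum>i=0..last_index D. \<Sum>j\<le>k. of_nat (k choose j) * (- c) ^ (k - j)
          * (coefficient D i * (c + node D i) ^ j))"
    by (simp add: sum_distrib_left mult_ac)
  also have "\<dots> = (\<Sum>j\<le>k. of_nat (k choose j) * (- c) ^ (k - j)
      * apply_difference c D 1 (\<lambda>x. x ^ j))"
    by (subst sum.swap) (simp add: sum_distrib_left apply_difference_def)
  also have "\<dots> = 0"
    using assms by (intro sum.neutral) (auto simp: has_order_def)
  finally show ?thesis .
qed

text \<open>The function of \<open>x\<close> that equals \<open>(x - c) ^ k\<close> on \<open>c + G\<close> and vanishes elsewhere.\<close>

definition cut_off_power :: "real set \<Rightarrow> nat \<Rightarrow> real \<Rightarrow> real \<Rightarrow> real" where
  "cut_off_power G k c x = (if x - c \<in> G then (x - c) ^ k else 0)"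

lemma apply_difference_cut_off_power:
  assumes "k \<ge> 1"
    and inv: "\<And>i x. i \<le> last_index D \<Longrightarrow> node D i \<noteq> 0 \<Longrightarrow> node D i * x \<in> G \<longleftrightarrow> x \<in> G"
    and "(\<Sum>i=0..last_index D. coefficient D i * node D i ^ k) = 0"
  shows "apply_difference c D h (cut_off_power G k c) = 0"
proof -
  have "apply_difference c D h (cut_off_power G k c)
      = (\<Sum>i=0..last_index D. (if h \<in> G then h ^ k else 0) * (coefficient D i * node D i ^ k))"
    unfolding apply_difference_def
  proof (rule sum.cong)
    fix i assume "i \<in> {0..last_index D}"
    then show "coefficient D i * cut_off_power G k c (c + node D i * h)
        = (if h \<in> G then h ^ k else 0) * (coefficient D i * node D i ^ k)"
      using assms(1) inv[of i h]
      by (cases "node D i = 0") (auto simp: cut_off_power_def power_mult_distrib)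
  qed simp
  then show ?thesis
    using assms(3) by (simp flip: sum_distrib_left)
qed

lemma peano_differentiable_cut_off_power:
  assumes "k \<ge> 1"
  shows "peano_differentiable (k - 1) (cut_off_power G k c) c"
proof -
  have "cut_off_power G k c (c + h) / h ^ (k - 1) = (if h \<in> G then h else 0)" for h
    using assms by (cases k) (auto simp: cut_off_power_def)
  then have "((\<lambda>h. cut_off_power G k c (c + h) / h ^ (k - 1)) \<longlongrightarrow> 0) (at 0)"
    by (intro tendsto_0_le[OF tendsto_ident_at, where K = 1]) simp
  then show ?thesis
    unfolding peano_differentiable_def by (intro exI[of _ 0]) simp
qed

lemma not_peano_differentiable_cut_off_power:
  assumes "countable G" and "1 \<in> G" and two: "\<And>x. 2 * x \<in> G \<longleftrightarrow> x \<in> G"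
  shows "\<not> peano_differentiable k (cut_off_power G k c) c"
proof
  assume "peano_differentiable k (cut_off_power G k c) c"
  then obtain p where
    p: "((\<lambda>h. (cut_off_power G k c (c + h) - poly p (c + h)) / h ^ k) \<longlongrightarrow> 0) (at 0)"
    by (auto simp: peano_differentiable_def)
  \<comment> \<open>the approximating polynomial in the variable \<open>h\<close>\<close>
  define Q where "Q = pcompose p [:c, 1:]"
  have Q: "poly Q h = poly p (c + h)" for h
    by (simp add: Q_def poly_pcompose)
  have G_div: "x / 2 ^ m \<in> G \<longleftrightarrow> x \<in> G" for x and m :: nat
  proof (induction m)
    case (Suc m)
    then show ?case using two[of "x / 2 ^ Suc m"] by simp
  qed simp
  have to_0: "filterlim (\<lambda>m. x / 2 ^ m) (at 0) sequentially" if "x \<noteq> 0" for x :: real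
    using that LIMSEQ_divide_realpow_zero[of 2 x] by (auto simp: filterlim_at)
  have "uncountable (UNIV - insert 0 G)"
    using assms(1) by (intro uncountable_minus_countable uncountable_UNIV_real) simp
  then obtain t where t: "t \<noteq> 0" "t \<notin> G"
    by (metis DiffE countable_empty equals0I insertCI)
  let ?F = "filtermap (\<lambda>m. t / 2 ^ m) sequentially"
  have "(\<lambda>m. - (poly Q (t / 2 ^ m) / (t / 2 ^ m) ^ k)) \<longlonglongrightarrow> 0"
    using filterlim_compose[OF p to_0[OF t(1)]] t(2) G_div by (simp add: cut_off_power_def Q)
  then have "((\<lambda>h. poly Q h / h ^ k) \<longlongrightarrow> 0) ?F"
    using tendsto_minus_cancel_left[of _ 0] by (fastforce simp: filterlim_filtermap)
  moreover have "?F \<le> at 0"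
    using to_0[OF t(1)] by (simp add: filterlim_def)
  ultimately have "((\<lambda>h. poly Q h / h ^ k) \<longlongrightarrow> 0) (at 0)"
    by (intro poly_small_along_filter[of ?F]) (auto simp: filtermap_bot_iff)
  then have "((\<lambda>h. (cut_off_power G k c (c + h) - poly p (c + h)) / h ^ k + poly Q h / h ^ k)
      \<longlongrightarrow> 0 + 0) (at 0)"
    by (intro tendsto_add p)
  then have "((\<lambda>h. cut_off_power G k c (c + h) / h ^ k) \<longlongrightarrow> 0) (at 0)"
    by (simp add: Q flip: add_divide_distrib)
  from filterlim_compose[OF this to_0[of 1]]
  have "(\<lambda>m. (1 / 2 ^ m) ^ k / (1 / 2 ^ m) ^ k :: real) \<longlonglongrightarrow> 0"
    using G_div[of 1] assms(2) by (simp add: cut_off_power_def)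
  then show False
    by (simp add: LIMSEQ_const_iff)
qed

lemma exists_non_peano_differentiable_annihilated:
  assumes "k \<ge> 1" and "finite \<D>"
    and "\<forall>D\<in>\<D>. \<exists>p>k. has_order c D p"
  shows "\<exists>f. peano_differentiable (k - 1) f c \<and>
    (\<forall>D\<in>\<D>. \<forall>h. apply_difference c D h f = 0) \<and> \<not> peano_differentiable k f c"
proof -
  \<comment> \<open>\<open>2\<close> makes \<open>G\<close> and its complement accumulate at \<open>0\<close>, even when all nodes are \<open>0\<close> or \<open>\<plusminus>1\<close>\<close>
  define S where "S = insert 2 (\<Union>D\<in>\<D>. node D ` {..last_index D}) - {0}"
  have "finite S"
    using assms(2) by (simp add: S_def)
  then have "countable S"
    by (rule countable_finite)
  then obtain G where G: "countable G" "1 \<in> G" "\<And>s x. s \<in> S \<Longrightarrow> s * x \<in> G \<longleftrightarrow> x \<in> G"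
    using countable_multiplicatively_invariant_set[of S] by (auto simp: S_def)
  have "apply_difference c D h (cut_off_power G k c) = 0" if "D \<in> \<D>" for D h
  proof (rule apply_difference_cut_off_power[OF assms(1)])
    show "node D i * x \<in> G \<longleftrightarrow> x \<in> G" if "i \<le> last_index D" "node D i \<noteq> 0" for i x
      using that \<open>D \<in> \<D>\<close> by (intro G(3)) (auto simp: S_def)
    show "(\<Sum>i=0..last_index D. coefficient D i * node D i ^ k) = 0"
      using that assms(3) has_order_imp_node_power_sum_eq_0 by blast
  qed
  moreover have "\<not> peano_differentiable k (cut_off_power G k c) c"
    using G by (intro not_peano_differentiable_cut_off_power) (auto simp: S_def)
  ultimately show ?thesis
    using peano_differentiable_cut_off_power[OF assms(1)] by blast
qed

theorem theorem0p10:
  fixes n :: nat and c :: real and \<D> :: "difference set"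
  assumes "n \<ge> 2"
    and "finite \<D>"
    and "\<forall>D\<in>\<D>. is_difference D"
    and "\<forall>D\<in>\<D>. \<exists>p\<ge>n. has_order c D p"
  shows "(\<exists>f :: real \<Rightarrow> real.
            peano_differentiable (n - 2) f c \<and>
            (\<forall>D\<in>\<D>. \<forall>h. apply_difference c D h f = 0) \<and>
            \<not> peano_differentiable n f c) \<and>
         ((\<forall>D\<in>\<D>. \<exists>p>n. has_order c D p) \<longrightarrow>
          (\<exists>f :: real \<Rightarrow> real.
            peano_differentiable (n - 1) f c \<and>
            (\<forall>D\<in>\<D>. \<forall>h. apply_difference c D h f = 0) \<and>
            \<not> peano_differentiable n f c))"
proof (intro conjI impI)
  have "n - 1 \<ge> 1" "n - 1 - 1 = n - 2"
    using assms(1) by simp_all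
  moreover have "\<forall>D\<in>\<D>. \<exists>p>n - 1. has_order c D p"
    using assms(1,4) by (meson diff_less less_le_trans pos2 zero_less_one)
  ultimately obtain f where "peano_differentiable (n - 2) f c"
      "\<forall>D\<in>\<D>. \<forall>h. apply_difference c D h f = 0" "\<not> peano_differentiable (n - 1) f c"
    using exists_non_peano_differentiable_annihilated[of "n - 1" \<D> c] assms(2) by metis
  then show "\<exists>f. peano_differentiable (n - 2) f c \<and>
      (\<forall>D\<in>\<D>. \<forall>h. apply_difference c D h f = 0) \<and> \<not> peano_differentiable n f c"
    using peano_differentiable_mono[of n f c "n - 1"] by auto
next
  assume "\<forall>D\<in>\<D>. \<exists>p>n. has_order c D p"
  then show "\<exists>f. peano_differentiable (n - 1) f c \<and>
      (\<forall>D\<in>\<D>. \<forall>h. apply_difference c D h f = 0) \<and> \<not> peano_differentiable n f c"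
    using assms(1,2) by (intro exists_non_peano_differentiable_annihilated) auto
qed

end
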